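(* Consider the plant $\dot x(t)=Ax(t)+Bu(t)$, $y(t)=Cx(t)$ with $x(t)\in\mathbb{R}^n$, $u(t)\in\mathbb{R}^m$, $y(t)\in\mathbb{R}$, $(A,B)$ controllable and $(C,A)$ observable. Let $\alpha=0$ (ramp case) or $\alpha=\omega^2$ with $\omega>0$ (sinusoidal case), and assume that $\operatorname{rank}\begin{bmatrix} A-\sigma I_n & B \\ C & 0 \end{bmatrix}=n+1$ for every $\sigma\in\mathbb{C}$ with $\sigma^2+\alpha=0$. Let $X\in\mathbb{R}^{l_x\times n}$, $U\in\mathbb{R}^{l_u\times m}$, $X_{I_1},X_{I_2}\in\mathbb{R}^{2}$, let $R=\begin{bmatrix} 1 \\ -1 \end{bmatrix}$, let $\rho\in\mathbb{R}^2$ be componentwise positive, and let $\mathcal{X}$, $\mathcal{U}$, $\mathcal{X}_{cl}$, $\mathcal{R}(\rho)$ be the associated polyhedral sets (see context). Let $K,K_{I_1},K_{I_2},K_r\in\mathbb{R}^m$ be control gains, let $n_{cl}=n+2$, and consider the closed-loop system $\dot x_{cl}=A_{cl}x_{cl}+B_{cl}r$ with $$A_{cl}=\begin{bmatrix} A+BKC & BK_{I_1} & BK_{I_2} \\ -C & 0 & -\alpha \\ 0 & 1 & 0 \end{bmatrix},\qquad B_{cl}=\begin{bmatrix} BK_r \\ 1 \\ 0 \end{bmatrix},\qquad x_{cl}=\begin{bmatrix} x \\ x_{I_1} \\ x_{I_2} \end{bmatrix}\in\mathbb{R}^{n_{cl}}.$$ Let $l>n_{cl}$, let $L\in\mathbb{R}^{l\times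 n}$, $L_{I_1},L_{I_2}\in\mathbb{R}^{l\times 1}$, $L_{cl}=\begin{bmatrix} L & L_{I_1} & L_{I_2} \end{bmatrix}$, and $\mathcal{L}=\{x_{cl}\in\mathbb{R}^{n_{cl}}: L_{cl}x_{cl}\le \mathbf{1}_l\}$. Assume the following. (a) There exist a Metzler matrix $H\in\mathbb{R}^{l\times l}$, an entrywise non-negative matrix $H_r\in\mathbb{R}^{l\times 2}$ and a scalar $\gamma>0$ such that $$HL=L(A+BKC)-L_{I_1}C,\quad HL_{I_1}=LBK_{I_1}+L_{I_2},\quad HL_{I_2}=LBK_{I_2}-\alpha L_{I_1},$$ $$H_rR=LBK_r+L_{I_1},\quad H\mathbf{1}_l+H_r\rho\le-\gamma\mathbf{1}_l.$$ (b) There exist $V_1\in\mathbb{R}^{n\times l}$ and $V_2,V_3\in\mathbb{R}^{1\times l}$ such that $\begin{bmatrix} V_1 \\ V_2 \\ V_3 \end{bmatrix}\begin{bmatrix} L & L_{I_1} & L_{I_2} \end{bmatrix}=I_{n_{cl}}$. (c) There exist entrywise non-negative matrices $T_1\in\mathbb{R}^{l_x\times l}$, $T_2,T_3\in\mathbb{R}^{2\times l}$ such that $$\begin{bmatrix} T_1 \\ T_2 \\ T_3 \end{bmatrix}\begin{bmatrix} L & L_{I_1} & L_{I_2} \end{bmatrix}=\begin{bmatrix} X & 0 & 0 \\ 0 & X_{I_1} & 0 \\ 0 & 0 & X_{I_2} \end{bmatrix},\quad T_1\mathbf{1}_l\le\mathbf{1}_{l_x},\quad T_2\mathbf{1}_l\le\mathbf{1}_2,\quad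 T_3\mathbf{1}_l\le\mathbf{1}_2.$$ (d) There exist entrywise non-negative matrices $Q\in\mathbb{R}^{l_u\times l}$ and $Q_r\in\mathbb{R}^{l_u\times 2}$ such that $$QL=UKC,\quad QL_{I_1}=UK_{I_1},\quad QL_{I_2}=UK_{I_2},\quad Q_rR=UK_r,\quad Q\mathbf{1}_l+Q_r\rho\le\mathbf{1}_{l_u}.$$ Then: 1. $\mathcal{L}$ is robust positively invariant for the closed-loop system with respect to signals $r(t)\in\mathcal{R}(\rho)$; 2. $\mathcal{L}\subseteq\mathcal{X}_{cl}$ and $\begin{bmatrix} KC & K_{I_1} & K_{I_2} \end{bmatrix}\mathcal{L}\oplus K_r\mathcal{R}(\rho)\subseteq\mathcal{U}$, where $\oplus$ is the Minkowski sum; 3. for every initial condition $x_{cl}(0)\in\mathcal{L}$ and every reference signal $r$ satisfying $\ddot r(t)+\alpha r(t)=0$ and $r(t)\in\mathcal{R}(\rho)$ for all $t\ge0$, the output $y(t)=Cx(t)$ of the closed-loop system asymptotically tracks $r$, i.e. $r(t)-y(t)\to0$ as $t\to\infty$, and the closed-loop trajectory satisfies the constraints $x_{cl}(t)\in\mathcal{X}_{cl}$ (in particular $x(t)\in\mathcal{X}$) and $u(t)\in\mathcal{U}$ for all $t\ge0$, where $u(t)=Ky(t)+K_{I_1}x_{I_1}(t)+K_{I_2}x_{I_2}(t)+K_rr(t)$.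
   Context: All vector inequalities are componentwise; $\mathbf{1}_k\in\mathbb{R}^k$ is the all-ones vector. A square matrix $M$ is Metzler if $M_{ij}\ge0$ for all $i\ne j$. Constraint sets: $\mathcal{X}=\{x\in\mathbb{R}^n: Xx\le\mathbf{1}_{l_x}\}$ (state constraints), $\mathcal{U}=\{u\in\mathbb{R}^m: Uu\le\mathbf{1}_{l_u}\}$ (input constraints), $\mathcal{R}(\rho)=\{r\in\mathbb{R}: Rr\le\rho\}=[-\rho_2,\rho_1]$ (reference bounds), and $$\mathcal{X}_{cl}=\{(x,x_{I_1},x_{I_2})\in\mathbb{R}^{n}\times\mathbb{R}\times\mathbb{R}: Xx\le\mathbf{1}_{l_x},\ X_{I_1}x_{I_1}\le\mathbf{1}_2,\ X_{I_2}x_{I_2}\le\mathbf{1}_2\}.$$ Controller: $u=Ky+K_{I_1}x_{I_1}+K_{I_2}x_{I_2}+K_rr$ with $\dot x_{I_1}=r-y-\alpha x_{I_2}$ and $\dot x_{I_2}=x_{I_1}$, which gives the closed-loop system in the claim. Reference signals: solutions of $\ddot r+\alpha r=0$ with unknown initial conditions (ramp type for $\alpha=0$, sinusoidal of angular frequency $\omega$ for $\alpha=\omega^2$). Robust positive invariance: a polyhedral set $\mathcal{P}$ is robust positively invariant (RPI) for a system $\dot x(t)=f(x(t),d(t))$, $t\ge0$, with $d(t)$ in a compact polyhedral set $\Delta$, if for every initial state $x(0)\in\mathcal{P}$ and every (measurable) signal $d$ with $d(t)\in\Delta$ for all $t\ge 0$, the state trajectory remains bounded and $x(t)\in\mathcal{P}$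 for all $t\ge0$. In the claim this is applied to the closed-loop system with $d=r$ and $\Delta=\mathcal{R}(\rho)$. *)

theory Defs
  imports "HOL-Analysis.Analysis" "HOL-Library.Set_Algebras"
begin

text \<open>
  Inequalities between vectors and matrices are the componentwise order of the type
  \<open>vec\<close>, and \<open>1\<close> of type \<open>real ^ 'k\<close> is the all-ones vector
  (the identity matrix is \<open>mat 1\<close>).  Vectors that enter matrix products are one-column
  matrices; a scalar \<open>r\<close> used as a one-dimensional vector is \<open>vec r\<close>.
\<close>

section \<open>Block matrices\<close>

definition hcat :: "'a ^ 'm ^ 'k \<Rightarrow> 'a ^ 'n ^ 'k \<Rightarrow> 'a ^ ('m + 'n) ^ 'k" where
  "hcat M N = (\<chi> i j. case j of Inl a \<Rightarrow> M $ i $ a | Inr b \<Rightarrow> N $ i $ b)"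

text \<open>On vectors, \<open>vcat x y\<close> is the stacked column vector; on matrices it stacks rows.\<close>

definition vcat :: "'a ^ 'm \<Rightarrow> 'a ^ 'n \<Rightarrow> 'a ^ ('m + 'n)" where
  "vcat x y = (\<chi> i. case i of Inl a \<Rightarrow> x $ a | Inr b \<Rightarrow> y $ b)"

definition metzler :: "real ^ 'n ^ 'n \<Rightarrow> bool" where
  "metzler M \<longleftrightarrow> (\<forall>i j. i \<noteq> j \<longrightarrow> 0 \<le> M $ i $ j)"


section \<open>Trajectories, controllability, observability, invariance\<close>

text \<open>
  Caratheodory solutions on \<open>[0, \<infinity>)\<close> of \<open>x' = f(x, d)\<close>, in integral form: the
  integrand is Lebesgue integrable on every \<open>[0, t]\<close>, so \<open>x\<close> is locally absolutely
  continuous and satisfies the equation almost everywhere.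
\<close>

definition trajectory :: "('s::euclidean_space \<Rightarrow> 'd \<Rightarrow> 's) \<Rightarrow> (real \<Rightarrow> 'd) \<Rightarrow> (real \<Rightarrow> 's) \<Rightarrow> bool" where
  "trajectory f d x \<longleftrightarrow>
     (\<forall>t\<ge>0. (\<lambda>s. f (x s) (d s)) absolutely_integrable_on {0..t} \<and>
            x t = x 0 + integral {0..t} (\<lambda>s. f (x s) (d s)))"

definition measurable_signal :: "(real \<Rightarrow> 'd::euclidean_space) \<Rightarrow> bool" where
  "measurable_signal d \<longleftrightarrow> d \<in> borel_measurable (lebesgue_on {0..})"

text \<open>Every state can be steered to every other state in finite time.\<close>

definition controllable :: "real ^ 'n ^ 'n \<Rightarrow> real ^ 'm ^ 'n \<Rightarrow> bool" where
  "controllable A B \<longleftrightarrow>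
     (\<forall>x0 x1. \<exists>T>0. \<exists>u x. measurable_signal u \<and>
        trajectory (\<lambda>z v. A *v z + B *v v) u x \<and> x 0 = x0 \<and> x T = x1)"

text \<open>The output on some finite time interval determines the initial state.\<close>

definition observable :: "real ^ 'n ^ 'p \<Rightarrow> real ^ 'n ^ 'n \<Rightarrow> bool" where
  "observable C A \<longleftrightarrow>
     (\<exists>T>0. \<forall>x z. trajectory (\<lambda>w (_::unit). A *v w) (\<lambda>_. ()) x \<longrightarrow>
        trajectory (\<lambda>w (_::unit). A *v w) (\<lambda>_. ()) z \<longrightarrow>
        (\<forall>t\<in>{0..T}. C *v x t = C *v z t) \<longrightarrow> x 0 = z 0)"

text \<open>
  Existence of a trajectory is part of the definition, so that invariance is never vacuous.
\<close>

definition robust_positively_invariant ::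
    "('s::euclidean_space \<Rightarrow> 'd::euclidean_space \<Rightarrow> 's) \<Rightarrow> 'd set \<Rightarrow> 's set \<Rightarrow> bool" where
  "robust_positively_invariant f \<Delta> P \<longleftrightarrow>
     (\<forall>x0\<in>P. \<forall>d. measurable_signal d \<longrightarrow> (\<forall>t\<ge>0. d t \<in> \<Delta>) \<longrightarrow>
        (\<exists>x. trajectory f d x \<and> x 0 = x0) \<and>
        (\<forall>x. trajectory f d x \<longrightarrow> x 0 = x0 \<longrightarrow>
           bounded (x ` {0..}) \<and> (\<forall>t\<ge>0. x t \<in> P)))"


section \<open>Constraint sets and reference signals\<close>

definition unit_polyhedron :: "real ^ 'n ^ 'k \<Rightarrow> (real ^ 'n) set" where
  "unit_polyhedron M = {x. M *v x \<le> 1}"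

definition R_mat :: "real ^ 1 ^ 2" where
  "R_mat = vector [vector [1], vector [-1]]"

definition ref_set :: "real ^ 2 \<Rightarrow> real set" where
  "ref_set \<rho> = {r. R_mat *v vec r \<le> \<rho>}"

definition X_cl :: "real ^ 'n ^ 'lx \<Rightarrow> real ^ 1 ^ 2 \<Rightarrow> real ^ 1 ^ 2 \<Rightarrow> (real ^ ('n + 1 + 1)) set" where
  "X_cl X XI1 XI2 =
     {vcat x (vcat xI1 xI2) | x xI1 xI2. X *v x \<le> 1 \<and> XI1 *v xI1 \<le> 1 \<and> XI2 *v xI2 \<le> 1}"

text \<open>\<open>r'' + \<alpha> r = 0\<close> on \<open>[0, \<infinity>)\<close>, with one-sided derivatives at \<open>0\<close>.\<close>

definition reference_signal :: "real \<Rightarrow> (real \<Rightarrow> real) \<Rightarrow> bool" where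
  "reference_signal \<alpha> r \<longleftrightarrow>
     (\<exists>r' r''. \<forall>t\<ge>0. (r has_real_derivative r' t) (at t within {0..}) \<and>
        (r' has_real_derivative r'' t) (at t within {0..}) \<and> r'' t + \<alpha> * r t = 0)"


section \<open>The closed loop\<close>

definition A_cl :: "real ^ 'n ^ 'n \<Rightarrow> real ^ 'm ^ 'n \<Rightarrow> real ^ 'n ^ 1 \<Rightarrow> real \<Rightarrow>
    real ^ 1 ^ 'm \<Rightarrow> real ^ 1 ^ 'm \<Rightarrow> real ^ 1 ^ 'm \<Rightarrow> real ^ ('n + 1 + 1) ^ ('n + 1 + 1)" where
  "A_cl A B C \<alpha> K KI1 KI2 =
     vcat (hcat (A + B ** K ** C) (hcat (B ** KI1) (B ** KI2)))
    (vcat (hcat (- C)             (hcat 0          (mat (- \<alpha>))))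
          (hcat 0                 (hcat (mat 1)    0)))"

definition B_cl :: "real ^ 'm ^ 'n \<Rightarrow> real ^ 1 ^ 'm \<Rightarrow> real ^ 1 ^ ('n + 1 + 1)" where
  "B_cl B Kr = vcat (B ** Kr) (vcat (mat 1) 0)"

definition closed_loop :: "real ^ 'n ^ 'n \<Rightarrow> real ^ 'm ^ 'n \<Rightarrow> real ^ 'n ^ 1 \<Rightarrow> real \<Rightarrow>
    real ^ 1 ^ 'm \<Rightarrow> real ^ 1 ^ 'm \<Rightarrow> real ^ 1 ^ 'm \<Rightarrow> real ^ 1 ^ 'm \<Rightarrow>
    real ^ ('n + 1 + 1) \<Rightarrow> real \<Rightarrow> real ^ ('n + 1 + 1)" where
  "closed_loop A B C \<alpha> K KI1 KI2 Kr x r = A_cl A B C \<alpha> K KI1 KI2 *v x + B_cl B Kr *v vec r"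

end

theory Submission
  imports Defs
begin

text \<open>
  Along the closed loop, \<open>z = L_cl x_cl\<close> obeys \<open>z' = H z + H_r R r\<close>.  Since \<open>H\<close> is Metzler and
  \<open>H 1 + H_r \<rho> < 0\<close>, no component of \<open>z\<close> can cross the level \<open>1\<close>; the same comparison for
  \<open>- z\<close> gives boundedness, because \<open>L_cl\<close> has a left inverse.  The inclusions are
  the easy direction of Farkas' lemma.  For tracking, \<open>v = x_cl'' + \<alpha> x_cl\<close> solves the unforced
  system \<open>v' = A_cl v\<close> because \<open>r'' + \<alpha> r = 0\<close>.  As \<open>H 1 \<le> - \<gamma> 1\<close>, the comparison applied
  to \<open>exp (\<gamma> t / 2) L_cl v\<close> and its negative yields \<open>v \<rightarrow> 0\<close>, and the last component of \<open>v\<close> is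
  \<open>x_I2'' + \<alpha> x_I2 = r - y\<close>.
\<close>

section \<open>Comparison for Metzler systems\<close>

text \<open>Off the diagonal the entries are non-negative, so replacing \<open>z $ j\<close> by the
  larger \<open>k\<close> can only increase the row. The diagonal entry may have any sign, but there
  \<open>z $ i = k\<close> and nothing changes.\<close>

lemma metzler_row_le:
  fixes H :: "real ^ 'l ^ 'l"
  assumes "metzler H" "\<And>j. z $ j \<le> k" "z $ i = k"
  shows "(H *v z) $ i \<le> k * (H *v 1) $ i"
proof -
  have "H $ i $ j * z $ j \<le> H $ i $ j * k" for j
    using assms by (cases "i = j") (auto simp: metzler_def intro: mult_left_mono)
  then show ?thesis
    by (simp add: matrix_vector_mult_def sum_distrib_left sum_mono mult.commute)
qed

text \<open>
  The hypothesis \<open>decr\<close> encodes \<open>z' \<le> H z + b\<close> almost everywhere.  At the last time before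
  an exit of the box \<open>z \<le> k\<close>, every active component has a negative derivative, because
  the off-diagonal entries of \<open>H\<close> cannot help the others to push it out.
\<close>

lemma metzler_comparison:
  fixes H :: "real ^ 'l ^ 'l" and z :: "real \<Rightarrow> real ^ 'l"
  assumes H: "metzler H"
    and cont: "continuous_on {0..} z"
    and init: "\<And>i. z 0 $ i \<le> k"
    and barrier: "\<And>i. k * (H *v 1) $ i + b $ i < 0"
    and decr: "\<And>i s t. 0 \<le> s \<Longrightarrow> s \<le> t \<Longrightarrow> (\<And>u. u \<in> {s..t} \<Longrightarrow> (H *v z u) $ i + b $ i \<le> 0) \<Longrightarrow>
       z t $ i \<le> z s $ i"
    and t: "0 \<le> t"
  shows "z t $ i \<le> k"
proof (rule ccontr)
  assume exit: "\<not> z t $ i \<le> k"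
  \<comment> \<open>\<open>S\<close> collects the times in \<open>{0..t}\<close> at which the whole
    box holds, not just component \<open>i\<close>. It is compact and contains \<open>0\<close>, so
    it has a largest element \<open>a\<close>, the last time inside the box.\<close>
  define S where "S = {s \<in> {0..t}. \<forall>i. z s $ i \<le> k}"
  have contt: "continuous_on {0..t} z"
    by (rule continuous_on_subset[OF cont]) auto
  have "closed {s \<in> {0..t}. z s $ i \<le> k}" for i
    by (intro continuous_on_closed_Collect_le bounded_linear.continuous_on[OF bounded_linear_vec_nth] contt continuous_on_const closed_atLeastAtMost)
  then have "closed (\<Inter>i. {s \<in> {0..t}. z s $ i \<le> k})"
    by blast
  moreover have "(\<Inter>i. {s \<in> {0..t}. z s $ i \<le> k}) = S"
    by (auto simp: S_def)
  ultimately have "closed S" by simp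
  moreover have "bounded S"
    by (rule bounded_subset[of "{0..t}"]) (auto simp: S_def)
  ultimately have "compact S"
    by (simp add: compact_eq_bounded_closed)
  moreover have "0 \<in> S"
    using init t by (auto simp: S_def)
  ultimately obtain a where a: "a \<in> S" "\<And>s. s \<in> S \<Longrightarrow> s \<le> a"
    by (metis compact_attains_sup empty_iff)
  have a0: "0 \<le> a" "a \<le> t" and za: "\<And>i. z a $ i \<le> k"
    using a by (auto simp: S_def)
  then have "a < t"
    using exit by (metis order_le_less)
  have lim: "(z \<longlongrightarrow> z a) (at_right a)"
    using cont a0 by (auto simp: continuous_on_def intro: tendsto_within_subset)
  \<comment> \<open>An inactive component stays below \<open>k\<close> by continuity. For an active
    one the strict inequality at \<open>a\<close> persists on a short interval to the right, where
    \<open>decr\<close> forbids any increase.\<close>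
  have ev: "eventually (\<lambda>s. z s $ i \<le> k) (at_right a)" for i
  proof (cases "z a $ i = k")
    case False
    then have "z a $ i < k" using za[of i] by simp
    then have "eventually (\<lambda>s. z s $ i < k) (at_right a)"
      by (rule order_tendstoD(2)[OF tendsto_vec_nth[OF lim]])
    then show ?thesis by (rule eventually_mono) simp
  next
    case True
    have active: "(H *v z a) $ i + b $ i < 0"
      using metzler_row_le[OF H za True] barrier[of i] by simp
    have "((\<lambda>s. (H *v z s) $ i + b $ i) \<longlongrightarrow> (H *v z a) $ i + b $ i) (at_right a)"
      unfolding matrix_vector_mult_def using lim by (auto intro!: tendsto_eq_intros)
    then have "eventually (\<lambda>s. (H *v z s) $ i + b $ i < 0) (at_right a)"
      using active by (rule order_tendstoD)
    then obtain c where c: "c > a" "\<And>s. a < s \<Longrightarrow> s < c \<Longrightarrow> (H *v z s) $ i + b $ i < 0"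
      by (auto simp: eventually_at_right_field)
    have "z s $ i \<le> k" if "a < s" "s < c" for s
    proof -
      have "z s $ i \<le> z a $ i"
      proof (rule decr[OF a0(1)])
        show "(H *v z u) $ i + b $ i \<le> 0" if "u \<in> {a..s}" for u
          using active c(2)[of u] that \<open>s < c\<close> by (cases "u = a") auto
      qed (use that in simp)
      then show ?thesis using True by simp
    qed
    then show ?thesis using c(1) by (auto simp: eventually_at_right_field)
  qed
  have "eventually (\<lambda>s. \<forall>i. z s $ i \<le> k) (at_right a)"
    by (rule eventually_all_finite) (rule ev)
  moreover have "eventually (\<lambda>s. s < t) (at_right a)"
    using \<open>a < t\<close> by (auto simp: eventually_at_right_field)
  ultimately have "eventually (\<lambda>s. (\<forall>i. z s $ i \<le> k) \<and> s < t) (at_right a)"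
    by (rule eventually_conj)
  then obtain c where c: "c > a" "\<And>s. a < s \<Longrightarrow> s < c \<Longrightarrow> (\<forall>i. z s $ i \<le> k) \<and> s < t"
    unfolding eventually_at_right_field by blast
  \<comment> \<open>All components obey the bound just after \<open>a\<close>, so any such time
    contradicts the maximality of \<open>a\<close>.\<close>
  have "(a + c) / 2 \<in> S"
    using c(1) c(2)[of "(a + c) / 2"] a0 by (auto simp: S_def)
  then show False using a(2)[of "(a + c) / 2"] c(1) by simp
qed


section \<open>Trajectories\<close>

lemma trajectory_integrable:
  "trajectory f d x \<Longrightarrow> 0 \<le> t \<Longrightarrow> (\<lambda>s. f (x s) (d s)) integrable_on {0..t}"
  unfolding trajectory_def by (blast intro: set_lebesgue_integral_eq_integral(1))

lemma trajectory_eq: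
  "trajectory f d x \<Longrightarrow> 0 \<le> t \<Longrightarrow> x t = x 0 + integral {0..t} (\<lambda>s. f (x s) (d s))"
  unfolding trajectory_def by blast

text \<open>An indefinite integral is continuous without any regularity of the input. Working on
  \<open>{0..t+1}\<close> keeps \<open>t\<close> away from the right endpoint, so that
  neighbourhoods of \<open>t\<close> there agree with those in \<open>{0..}\<close>.\<close>

lemma trajectory_continuous_on:
  assumes "trajectory f d x"
  shows "continuous_on {0..} x"
  unfolding continuous_on_eq_continuous_within
proof
  fix t :: real assume t: "t \<in> {0..}"
  have int: "(\<lambda>s. f (x s) (d s)) integrable_on {0..t+1}"
    using t by (intro trajectory_integrable[OF assms]) auto
  have "continuous_on {0..t+1} (\<lambda>u. x 0 + integral {0..u} (\<lambda>s. f (x s) (d s)))"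
    by (intro continuous_intros indefinite_integral_continuous_1 int)
  then have "continuous_on {0..t+1} x"
    by (rule continuous_on_eq) (rule trajectory_eq[OF assms, symmetric], simp)
  then have "continuous (at t within {0..t+1}) x"
    using t by (simp add: continuous_on_eq_continuous_within)
  moreover have "at t within {0..} = at t within {0..t+1}"
    using t by (intro at_within_nhd[of _ "{..<t+1}"]) auto
  ultimately show "continuous (at t within {0..}) x" by simp
qed

text \<open>For a measurable input the state need not be differentiable everywhere, so monotonicity
  is read off the integral form, with \<open>p\<close> moved inside the integral. This is how
  \<open>decr\<close> in \<open>metzler_comparison\<close> is discharged.\<close>

lemma trajectory_functional_decreasing:
  assumes x: "trajectory f d x" and p: "bounded_linear (p :: _ \<Rightarrow> real)" and st: "0 \<le> s" "s \<le> t"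
    and le: "\<And>u. u \<in> {s..t} \<Longrightarrow> p (f (x u) (d u)) \<le> 0"
  shows "p (x t) \<le> p (x s)"
proof -
  interpret p: bounded_linear p by fact
  let ?g = "\<lambda>s. f (x s) (d s)"
  have int: "?g integrable_on {0..t}"
    using st by (intro trajectory_integrable[OF x]) auto
  then have int': "?g integrable_on {s..t}"
    by (rule integrable_subinterval_real) (use st in auto)
  have "x t = x s + integral {s..t} ?g"
    using trajectory_eq[OF x, of s] trajectory_eq[OF x, of t] st
      Henstock_Kurzweil_Integration.integral_combine[OF st int]
    by (simp add: add.assoc)
  then have "p (x t) = p (x s) + integral {s..t} (p \<circ> ?g)"
    by (simp add: p.add integral_linear[OF int' p])
  moreover have "integral {s..t} (p \<circ> ?g) \<le> integral {s..t} (\<lambda>_. 0)"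
    by (intro integral_le integrable_linear[OF int' p]) (use le in auto)
  ultimately show ?thesis by simp
qed

text \<open>Once the right-hand side is continuous, the fundamental theorem of calculus makes the
  solution classical. Tracking needs this, as it differentiates the closed loop twice.\<close>

lemma trajectory_has_vector_derivative:
  assumes x: "trajectory f d x" and cont: "continuous_on {0..} (\<lambda>s. f (x s) (d s))" and t: "0 \<le> t"
  shows "(x has_vector_derivative f (x t) (d t)) (at t within {0..})"
proof -
  have "((\<lambda>u. integral {0..u} (\<lambda>s. f (x s) (d s))) has_vector_derivative f (x t) (d t))
      (at t within {0..t+1})"
    using t by (intro integral_has_vector_derivative continuous_on_subset[OF cont]) auto
  then have "((\<lambda>u. x 0 + integral {0..u} (\<lambda>s. f (x s) (d s))) has_vector_derivative f (x t) (d t))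
      (at t within {0..t+1})"
    by (auto intro!: derivative_eq_intros)
  then have "(x has_vector_derivative f (x t) (d t)) (at t within {0..t+1})"
  proof (rule has_vector_derivative_transform[rotated 2])
    show "x u = x 0 + integral {0..u} (\<lambda>s. f (x s) (d s))" if "u \<in> {0..t+1}" for u
      using that by (intro trajectory_eq[OF x]) simp
  qed (use t in simp)
  moreover have "at t within {0..} = at t within {0..t+1}"
    using t by (intro at_within_nhd[of _ "{..<t+1}"]) auto
  ultimately show ?thesis by simp
qed

lemma trajectory_of_derivative:
  assumes x: "\<And>t. 0 \<le> t \<Longrightarrow> (x has_vector_derivative f (x t) (d t)) (at t within {0..})"
    and cont: "continuous_on {0..} (\<lambda>s. f (x s) (d s))"
  shows "trajectory f d x"
  unfolding trajectory_def
proof (intro allI impI conjI)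
  fix t :: real assume t: "0 \<le> t"
  show "(\<lambda>s. f (x s) (d s)) absolutely_integrable_on {0..t}"
    by (intro absolutely_integrable_continuous_real continuous_on_subset[OF cont]) auto
  have "((\<lambda>s. f (x s) (d s)) has_integral x t - x 0) {0..t}"
    by (intro fundamental_theorem_of_calculus t has_vector_derivative_within_subset[OF x]) auto
  then show "x t = x 0 + integral {0..t} (\<lambda>s. f (x s) (d s))"
    by (simp add: integral_unique)
qed

section \<open>Global existence for linear systems with bounded measurable inputs\<close>

text \<open>The exponential integrates to at most \<open>exp (c * t) / c\<close>; the factor
  \<open>1 / c\<close> becomes the contraction constant once the weight is removed.\<close>

lemma integral_exp_weight_bound:
  fixes h :: "real \<Rightarrow> 'a::euclidean_space"
  assumes "continuous_on {0..} h" "\<And>s. 0 \<le> s \<Longrightarrow> norm (h s) \<le> D" "c > 0" "0 \<le> t"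
  shows "norm (integral {0..t} (\<lambda>s. exp (c * s) *\<^sub>R h s)) \<le> D * exp (c * t) / c"
proof -
  have D: "D \<ge> 0" using assms(2)[of 0] by (simp add: order_trans[OF norm_ge_zero])
  have I: "((\<lambda>s. D * exp (c * s)) has_integral D * exp (c * t) / c - D * exp (c * 0) / c) {0..t}"
    by (rule fundamental_theorem_of_calculus)
      (use assms in \<open>auto intro!: derivative_eq_intros
         simp: has_real_derivative_iff_has_vector_derivative[symmetric]\<close>)
  have "norm (integral {0..t} (\<lambda>s. exp (c * s) *\<^sub>R h s)) \<le> integral {0..t} (\<lambda>s. D * exp (c * s))"
  proof (rule integral_norm_bound_integral)
    show "(\<lambda>s. exp (c * s) *\<^sub>R h s) integrable_on {0..t}"
      by (intro integrable_continuous_real continuous_intros continuous_on_subset[OF assms(1)]) auto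
    show "norm (exp (c * s) *\<^sub>R h s) \<le> D * exp (c * s)" if "s \<in> {0..t}" for s
      using assms(2)[of s] that by (simp add: mult.commute)
  qed (use I in blast)
  also have "\<dots> \<le> D * exp (c * t) / c"
    unfolding integral_unique[OF I] using D assms(3) by simp
  finally show ?thesis .
qed

text \<open>
  Banach's fixed point theorem for \<open>y t = exp (- c t) x t\<close>, where a large \<open>c\<close> makes the
  Volterra operator a contraction on the whole half-line.
\<close>

lemma linear_volterra_solution:
  fixes A :: "'a::euclidean_space \<Rightarrow> 'a" and h :: "real \<Rightarrow> 'a"
  assumes A: "bounded_linear A" and h: "continuous_on {0..} h"
    and hb: "\<And>t. 0 \<le> t \<Longrightarrow> norm (h t) \<le> b * exp t"
  obtains x where "continuous_on {0..} x" "\<And>t. 0 \<le> t \<Longrightarrow> x t = h t + integral {0..t} (\<lambda>s. A (x s))"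
proof -
  interpret A: bounded_linear A by fact
  obtain M where M: "M > 0" "\<And>x. norm (A x) \<le> norm x * M"
    using A.pos_bounded by blast
  \<comment> \<open>This choice gives \<open>M / c \<le> 1/2\<close>, the contraction ratio, and
    \<open>c \<ge> 1\<close>, which absorbs the growth \<open>exp t\<close> of
    \<open>h\<close>.\<close>
  define c where "c = 2 * M + 1"
  have c: "c > 0" "c \<ge> 1" using M by (auto simp: c_def)
  define I where "I y t = integral {0..t} (\<lambda>s. exp (c * s) *\<^sub>R A (apply_bcontfun y s))" for y t
  \<comment> \<open>Bounded continuous functions live on the whole line, so \<open>max 0 t\<close>
    freezes the value at \<open>0\<close> for negative times.\<close>
  define F where "F y t = exp (- (c * max 0 t)) *\<^sub>R (h (max 0 t) + I y (max 0 t))" for y t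
  have contA: "continuous_on S (\<lambda>s. A (apply_bcontfun y s))" for S y
    by (intro A.continuous_on continuous_on_apply_bcontfun)
  have int: "(\<lambda>s. exp (c * s) *\<^sub>R A (apply_bcontfun y s)) integrable_on {0..t}" for y t
    by (intro integrable_continuous_real continuous_intros contA)
  have diff: "I y t - I z t = I (y - z) t" for y z t
    unfolding I_def integral_diff[OF int int, symmetric] by (simp add: A.diff scaleR_diff_right)
  have Ib: "norm (I y t) \<le> M * norm y * exp (c * t) / c" if "0 \<le> t" for y t
    unfolding I_def
  proof (rule integral_exp_weight_bound[OF contA _ c(1) that])
    show "norm (A (apply_bcontfun y s)) \<le> M * norm y" for s
      using M(2)[of "apply_bcontfun y s"] norm_bounded[of y s] M(1)
      by (smt (verit) mult.commute mult_left_mono)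
  qed
  have contI: "continuous_on {0..} (I y)" for y
  proof -
    \<comment> \<open>\<open>I y\<close> is a trajectory of a system driven by time alone, so
      continuity of trajectories can be reused.\<close>
    have "trajectory (\<lambda>_ s. exp (c * s) *\<^sub>R A (apply_bcontfun y s)) (\<lambda>s. s) (I y)"
      unfolding trajectory_def I_def
      by (auto intro!: absolutely_integrable_continuous_real continuous_intros contA)
    then show ?thesis by (rule trajectory_continuous_on)
  qed
  have F: "F y \<in> bcontfun" for y
  proof (rule bcontfun_normI)
    have "continuous_on UNIV (\<lambda>t. h (max 0 t))" "continuous_on UNIV (\<lambda>t. I y (max 0 t))"
      by (auto intro!: continuous_on_compose2[OF h] continuous_on_compose2[OF contI] continuous_intros)
    then show "continuous_on UNIV (F y)"
      unfolding F_def by (intro continuous_intros) auto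
    show "norm (F y t) \<le> b + M * norm y / c" for t
    proof -
      define s where "s = max 0 t"
      have s: "s \<ge> 0" by (simp add: s_def)
      have b: "b \<ge> 0" using order_trans[OF norm_ge_zero hb[of 0]] by simp
      have "exp s \<le> exp (c * s)" using c s mult_right_mono[of 1 c s] by simp
      then have "norm (h s) \<le> b * exp (c * s)"
        using hb[OF s] b by (meson mult_left_mono order_trans)
      then have "norm (h s + I y s) \<le> b * exp (c * s) + M * norm y * exp (c * s) / c"
        using Ib[OF s, of y] norm_triangle_ineq[of "h s" "I y s"] by linarith
      then have "norm (F y t) \<le> exp (- (c * s)) * (b * exp (c * s) + M * norm y * exp (c * s) / c)"
        by (simp add: F_def s_def[symmetric])
      also have "\<dots> = b + M * norm y / c"
        by (simp add: exp_minus field_simps)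
      finally show ?thesis .
    qed
  qed
  have "\<exists>!y. Bcontfun (F y) = y"
  proof (rule banach_fix_type[of "1/2"]; (intro allI)?)
    fix y z
    show "dist (Bcontfun (F y)) (Bcontfun (F z)) \<le> 1/2 * dist y z"
    proof (rule dist_bound)
      fix t :: real
      define s where "s = max 0 t"
      have s: "s \<ge> 0" by (simp add: s_def)
      have "F y t - F z t = exp (- (c * s)) *\<^sub>R I (y - z) s"
        by (simp add: F_def s_def[symmetric] diff[symmetric] algebra_simps)
      then have "norm (F y t - F z t) \<le> exp (- (c * s)) * (M * norm (y - z) * exp (c * s) / c)"
        using Ib[OF s, of "y - z"] by (simp del: times_divide_eq_right)
      also have "\<dots> = M / c * norm (y - z)"
        by (simp add: exp_minus field_simps)
      also have "\<dots> \<le> 1/2 * norm (y - z)"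
        using M(1) by (intro mult_right_mono) (auto simp: c_def field_simps)
      finally show "dist (apply_bcontfun (Bcontfun (F y)) t) (apply_bcontfun (Bcontfun (F z)) t)
          \<le> 1/2 * dist y z"
        by (simp add: Bcontfun_inverse F dist_norm)
    qed
  qed auto
  then obtain y where y: "Bcontfun (F y) = y" by blast
  define x where "x t = exp (c * t) *\<^sub>R apply_bcontfun y t" for t
  show thesis
  proof
    show "continuous_on {0..} x"
      unfolding x_def by (intro continuous_intros continuous_on_apply_bcontfun)
    fix t :: real assume t: "0 \<le> t"
    have "apply_bcontfun y t = F y t"
      by (subst y[symmetric]) (simp add: Bcontfun_inverse F)
    then have "x t = h t + I y t"
      using t by (simp add: x_def F_def exp_minus)
    then show "x t = h t + integral {0..t} (\<lambda>s. A (x s))"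
      by (simp add: I_def x_def A.scaleR)
  qed
qed

text \<open>Integrating the input first leaves a Volterra equation whose forcing \<open>h\<close> is
  continuous even if \<open>d\<close> is only measurable. Boundedness of \<open>d\<close> makes
  \<open>h\<close> grow at most linearly, hence within a multiple of \<open>exp t\<close>.\<close>

lemma linear_trajectory_exists:
  fixes A :: "'s::euclidean_space \<Rightarrow> 's" and B :: "'d::euclidean_space \<Rightarrow> 's"
  assumes A: "bounded_linear A" and B: "bounded_linear B"
    and d: "measurable_signal d" and db: "\<And>t. 0 \<le> t \<Longrightarrow> norm (d t) \<le> c"
  shows "\<exists>x. trajectory (\<lambda>x v. A x + B v) d x \<and> x 0 = x0"
proof -
  interpret A: bounded_linear A by fact
  interpret B: bounded_linear B by fact
  obtain M where M: "M > 0" "\<And>x. norm (B x) \<le> norm x * M"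
    using B.pos_bounded by blast
  have c: "c \<ge> 0" using db[of 0] norm_ge_zero[of "d 0"] by linarith
  have Bb: "norm (B (d t)) \<le> c * M" if "0 \<le> t" for t
    using M db[OF that] by (meson mult_right_mono less_imp_le order_trans)
  have Babs: "(\<lambda>s. B (d s)) absolutely_integrable_on {0..t}" if "0 \<le> t" for t
  proof (rule measurable_bounded_by_integrable_imp_absolutely_integrable)
    have "d \<in> borel_measurable (lebesgue_on {0..t})"
      using d unfolding measurable_signal_def
      by (rule measurable_restrict_mono) auto
    then show "(\<lambda>s. B (d s)) \<in> borel_measurable (lebesgue_on {0..t})"
      by (rule measurable_compose[OF _ borel_measurable_continuous_onI[OF B.continuous_on[OF continuous_on_id]]])
    show "(\<lambda>_. c * M) integrable_on {0..t}" by (rule integrable_const_ivl)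
  qed (use Bb in auto)
  define h where "h t = x0 + integral {0..t} (\<lambda>s. B (d s))" for t
  have "trajectory (\<lambda>_ v. B v) d h"
    using Babs by (auto simp: trajectory_def h_def)
  then have h: "continuous_on {0..} h" by (rule trajectory_continuous_on)
  have hb: "norm (h t) \<le> (norm x0 + c * M) * exp t" if t: "0 \<le> t" for t
  proof -
    have "norm (integral {0..t} (\<lambda>s. B (d s))) \<le> integral {0..t} (\<lambda>s. c * M)"
      using Babs[OF t] Bb
      by (intro integral_norm_bound_integral set_lebesgue_integral_eq_integral(1)) auto
    then have "norm (h t) \<le> norm x0 + t * (c * M)"
      using t norm_triangle_ineq[of x0 "integral {0..t} (\<lambda>s. B (d s))"] by (simp add: h_def mult.left_commute)
    also have "\<dots> \<le> exp t * norm x0 + exp t * (c * M)"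
    proof (intro add_mono mult_right_mono)
      show "norm x0 \<le> exp t * norm x0"
        using t by (simp add: mult_le_cancel_right1)
      show "t \<le> exp t"
        using exp_ge_add_one_self[of t] by linarith
    qed (use c M in simp)
    finally show ?thesis by (simp add: algebra_simps)
  qed
  obtain x where x: "continuous_on {0..} x" "\<And>t. 0 \<le> t \<Longrightarrow> x t = h t + integral {0..t} (\<lambda>s. A (x s))"
    using linear_volterra_solution[OF A h hb] by blast
  have Aabs: "(\<lambda>s. A (x s)) absolutely_integrable_on {0..t}" for t
    by (intro absolutely_integrable_continuous_real A.continuous_on continuous_on_subset[OF x(1)]) auto
  have x0: "x 0 = x0" using x(2)[of 0] by (simp add: h_def)
  have "trajectory (\<lambda>x v. A x + B v) d x"
    unfolding trajectory_def x0
  proof (intro allI impI conjI)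
    fix t :: real assume t: "0 \<le> t"
    show "(\<lambda>s. A (x s) + B (d s)) absolutely_integrable_on {0..t}"
      by (intro set_integral_add Aabs Babs t)
    show "x t = x0 + integral {0..t} (\<lambda>s. A (x s) + B (d s))"
      unfolding x(2)[OF t] h_def using Aabs[of t] Babs[OF t]
      by (subst integral_add) (auto intro: set_lebesgue_integral_eq_integral(1))
  qed
  then show ?thesis
    using x0 by blast
qed


section \<open>Polyhedral certificates\<close>

lemma nonneg_matrix_mono:
  fixes N :: "real ^ 'm ^ 'k"
  assumes "0 \<le> N" "p \<le> q"
  shows "N *v p \<le> N *v q"
  using assms unfolding less_eq_vec_def matrix_vector_mult_def
  by (auto intro!: sum_mono mult_left_mono)

lemma bounded_linear_mult_vec:
  fixes B :: "real ^ 1 ^ 'n"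
  shows "bounded_linear (\<lambda>r. B *v vec r)"
proof -
  have "linear (\<lambda>r. B *v vec r)"
    by (rule linearI) (simp_all add: vec_eq_iff matrix_vector_mult_def algebra_simps sum_1)
  then show ?thesis
    by (rule linear_conv_bounded_linear[THEN iffD1])
qed

lemma R_mat_nth: "(R_mat *v vec r) $ 1 = r" "(R_mat *v vec r) $ 2 = - r"
  by (simp_all add: R_mat_def matrix_vector_mult_def sum_1)

lemma ref_set_iff: "r \<in> ref_set \<rho> \<longleftrightarrow> - \<rho> $ 2 \<le> r \<and> r \<le> \<rho> $ 1"
  by (auto simp: ref_set_def less_eq_vec_def forall_2 R_mat_nth)

text \<open>The dynamics is studied for an arbitrary state matrix; the blocks of the closed loop
  appear only when the certificate is verified. By \<open>HM\<close> and \<open>HrR\<close> the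
  facet values \<open>M *v x\<close> obey a system of their own, and by \<open>VM\<close> they
  determine the state.\<close>

locale polyhedral_certificate =
  fixes A :: "real ^ 'n ^ 'n" and B :: "real ^ 1 ^ 'n" and M :: "real ^ 'n ^ 'l" and V :: "real ^ 'l ^ 'n"
    and H :: "real ^ 'l ^ 'l" and Hr :: "real ^ 2 ^ 'l" and \<rho> :: "real ^ 2" and \<gamma> :: real
  assumes metzler: "metzler H" and Hr: "0 \<le> Hr" and \<rho>: "0 \<le> \<rho>" and \<gamma>: "\<gamma> > 0"
    and HM: "H ** M = M ** A" and HrR: "Hr ** R_mat = M ** B"
    and contract: "H *v 1 + Hr *v \<rho> \<le> - \<gamma> *\<^sub>R 1"
    and VM: "V ** M = mat 1"
begin

definition sys :: "real ^ 'n \<Rightarrow> real \<Rightarrow> real ^ 'n" where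
  "sys x r = A *v x + B *v vec r"

lemma M_A: "M *v (A *v x) = H *v (M *v x)"
  by (simp add: matrix_vector_mul_assoc HM)

lemma M_sys: "M *v sys x r = H *v (M *v x) + Hr *v (R_mat *v vec r)"
  by (simp add: sys_def matrix_vector_right_distrib M_A) (simp add: matrix_vector_mul_assoc HrR)

lemma V_M: "V *v (M *v x) = x"
  by (simp add: matrix_vector_mul_assoc VM)

lemma contract_nth: "(H *v 1) $ i + (Hr *v \<rho>) $ i \<le> - \<gamma>"
  using contract by (auto simp: less_eq_vec_def)

lemma H_one_nth: "(H *v 1) $ i \<le> - \<gamma>"
proof -
  have "0 \<le> (Hr *v \<rho>) $ i"
    using nonneg_matrix_mono[OF Hr \<rho>] by (simp add: less_eq_vec_def)
  then show ?thesis using contract_nth[of i] by simp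
qed

text \<open>The factor \<open>c\<close> is \<open>1\<close> for upper bounds on facet values and
  \<open>- 1\<close> for lower ones.\<close>

lemma bounded_linear_M_nth: "bounded_linear (\<lambda>x. c * (M *v x) $ i)"
  by (intro bounded_linear_compose[OF bounded_linear_mult_right]
      bounded_linear_compose[OF bounded_linear_vec_nth] matrix_vector_mul_bounded_linear)

text \<open>The comparison is used at level \<open>1\<close> with the worst-case forcing
  \<open>Hr *v \<rho>\<close>, which dominates the actual one because \<open>Hr\<close> is
  non-negative and \<open>R_mat *v vec r \<le> \<rho>\<close>.\<close>

lemma invariant:
  assumes x: "trajectory sys r x" and r: "\<And>t. 0 \<le> t \<Longrightarrow> r t \<in> ref_set \<rho>"
    and x0: "x 0 \<in> unit_polyhedron M" and t: "0 \<le> t"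
  shows "x t \<in> unit_polyhedron M"
proof -
  have "(M *v x t) $ i \<le> 1" for i
  proof (rule metzler_comparison[OF metzler _ _ _ _ t])
    show "continuous_on {0..} (\<lambda>t. M *v x t)"
      by (intro matrix_vector_mult_linear_continuous_on[THEN continuous_on_compose2]
          trajectory_continuous_on[OF x]) auto
    show "(M *v x 0) $ i \<le> 1" for i
      using x0 by (simp add: unit_polyhedron_def less_eq_vec_def)
    show "1 * (H *v 1) $ i + (Hr *v \<rho>) $ i < 0" for i
      using contract_nth[of i] \<gamma> by simp
    fix i and s t :: real
    assume st: "0 \<le> s" "s \<le> t"
      and le: "\<And>u. u \<in> {s..t} \<Longrightarrow> (H *v (M *v x u)) $ i + (Hr *v \<rho>) $ i \<le> 0"
    have "1 * (M *v x t) $ i \<le> 1 * (M *v x s) $ i"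
    proof (rule trajectory_functional_decreasing[OF x bounded_linear_M_nth st])
      fix u assume u: "u \<in> {s..t}"
      have "(Hr *v (R_mat *v vec (r u))) $ i \<le> (Hr *v \<rho>) $ i"
        using nonneg_matrix_mono[OF Hr, of "R_mat *v vec (r u)" \<rho>] r[of u] u st
        by (simp add: ref_set_def less_eq_vec_def)
      then show "1 * (M *v sys (x u) (r u)) $ i \<le> 0"
        using le[OF u] by (simp add: M_sys)
    qed
    then show "(M *v x t) $ i \<le> (M *v x s) $ i" by simp
  qed
  then show ?thesis by (simp add: unit_polyhedron_def less_eq_vec_def)
qed

text \<open>Invariance bounds the facet values from above only. A second comparison, for
  \<open>- (M *v x t)\<close>, bounds them from below, and \<open>V\<close> carries the bound over
  to the state.\<close>

lemma bounded_trajectory: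
  assumes x: "trajectory sys r x" and r: "\<And>t. 0 \<le> t \<Longrightarrow> r t \<in> ref_set \<rho>"
    and x0: "x 0 \<in> unit_polyhedron M"
  shows "bounded (x ` {0..})"
proof -
  \<comment> \<open>The entries of \<open>- (R_mat *v vec r)\<close> are
    \<open>- r \<le> \<rho> $ 2\<close> and \<open>r \<le> \<rho> $ 1\<close>; as
    \<open>\<rho>\<close> is non-negative, the sum dominates both.\<close>
  define b where "b = Hr *v vec (\<rho> $ 1 + \<rho> $ 2)"
  have b: "- (Hr *v (R_mat *v vec s)) $ i \<le> b $ i" if "s \<in> ref_set \<rho>" for s i
  proof -
    have "- (R_mat *v vec s) \<le> vec (\<rho> $ 1 + \<rho> $ 2)"
      using that \<rho> by (auto simp: ref_set_iff less_eq_vec_def forall_2 R_mat_nth)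
    then have "(Hr *v - (R_mat *v vec s)) $ i \<le> b $ i"
      unfolding b_def using nonneg_matrix_mono[OF Hr] by (auto simp: less_eq_vec_def)
    then show ?thesis by (simp add: linear_neg[OF matrix_vector_mul_linear])
  qed
  \<comment> \<open>Large enough to dominate the initial values and, through
    \<open>b $ i < k * \<gamma>\<close> and \<open>H_one_nth\<close>, to be a strict barrier. The
    sum over the components replaces a maximum.\<close>
  define k where "k = 1 + (\<Sum>i\<in>UNIV. \<bar>b $ i\<bar> / \<gamma> + \<bar>(M *v x 0) $ i\<bar>)"
  have k: "1 + \<bar>b $ i\<bar> / \<gamma> + \<bar>(M *v x 0) $ i\<bar> \<le> k" for i
    unfolding k_def add.assoc using \<gamma>
    by (intro add_left_mono member_le_sum[of i UNIV "\<lambda>i. \<bar>b $ i\<bar> / \<gamma> + \<bar>(M *v x 0) $ i\<bar>"]) auto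
  have k0: "k \<ge> 0" and kM: "- (M *v x 0) $ i \<le> k" and kb: "b $ i < k * \<gamma>" for i
  proof -
    show "k \<ge> 0" using \<gamma> by (auto simp: k_def intro!: add_nonneg_nonneg sum_nonneg)
    have "0 \<le> \<bar>b $ i\<bar> / \<gamma>" using \<gamma> by simp
    then show "- (M *v x 0) $ i \<le> k" using k[of i] by linarith
    have "\<bar>b $ i\<bar> / \<gamma> < k" using k[of i] by linarith
    then show "b $ i < k * \<gamma>" using \<gamma> by (simp add: divide_less_eq)
  qed
  have lower: "(- (M *v x t)) $ i \<le> k" if t: "0 \<le> t" for t i
  proof (rule metzler_comparison[OF metzler _ _ _ _ t])
    show "continuous_on {0..} (\<lambda>t. - (M *v x t))"
      by (intro continuous_on_minus matrix_vector_mult_linear_continuous_on[THEN continuous_on_compose2]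
          trajectory_continuous_on[OF x]) auto
    show "(- (M *v x 0)) $ i \<le> k" for i
      using kM by simp
    show "k * (H *v 1) $ i + b $ i < 0" for i
      using mult_left_mono[OF H_one_nth k0, of i] kb[of i] by (simp add: mult.commute)
    fix i and s t :: real
    assume st: "0 \<le> s" "s \<le> t"
      and le: "\<And>u. u \<in> {s..t} \<Longrightarrow> (H *v - (M *v x u)) $ i + b $ i \<le> 0"
    have "- 1 * (M *v x t) $ i \<le> - 1 * (M *v x s) $ i"
    proof (rule trajectory_functional_decreasing[OF x bounded_linear_M_nth st])
      fix u assume u: "u \<in> {s..t}"
      then show "- 1 * (M *v sys (x u) (r u)) $ i \<le> 0"
        using le[OF u] b[OF r, of u i] st
        by (simp add: M_sys linear_neg[OF matrix_vector_mul_linear])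
    qed
    then show "(- (M *v x t)) $ i \<le> (- (M *v x s)) $ i" by simp
  qed
  have upper: "(M *v x t) $ i \<le> 1" if "0 \<le> t" for t i
    using invariant[OF x r x0 that] by (simp add: unit_polyhedron_def less_eq_vec_def)
  have "norm (M *v x t) \<le> real CARD('l) * (k + 1)" if "0 \<le> t" for t
  proof -
    have "\<bar>(M *v x t) $ i\<bar> \<le> k + 1" for i
      using lower[OF that, of i] upper[OF that, of i] k0 by (simp add: abs_le_iff)
    then show ?thesis
      using norm_le_l1_cart[of "M *v x t"] sum_bounded_above[of UNIV "\<lambda>i. \<bar>(M *v x t) $ i\<bar>" "k + 1"]
      by simp
  qed
  then have "bounded ((\<lambda>t. M *v x t) ` {0..})"
    by (auto simp: bounded_iff)
  then have "bounded ((*v) V ` (\<lambda>t. M *v x t) ` {0..})"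
    by (rule bounded_linear_image) simp
  then show ?thesis by (simp add: image_image V_M)
qed

lemma trajectory_exists:
  assumes "measurable_signal r" "\<And>t. 0 \<le> t \<Longrightarrow> r t \<in> ref_set \<rho>"
  shows "\<exists>x. trajectory sys r x \<and> x 0 = x0"
proof -
  have "norm (r t) \<le> \<bar>\<rho> $ 1\<bar> + \<bar>\<rho> $ 2\<bar>" if "0 \<le> t" for t
    using assms(2)[OF that] by (auto simp: ref_set_iff)
  then show ?thesis
    unfolding sys_def using assms(1)
    by (intro linear_trajectory_exists matrix_vector_mul_bounded_linear bounded_linear_mult_vec)
qed

lemma robust_positively_invariant:
  "robust_positively_invariant sys (ref_set \<rho>) (unit_polyhedron M)"
  unfolding robust_positively_invariant_def
  using trajectory_exists bounded_trajectory invariant by blast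

section \<open>Exponential decay without input, and the internal model\<close>

text \<open>The weight \<open>exp (\<gamma> / 2 * t)\<close> adds \<open>\<gamma> / 2\<close> to the
  diagonal of \<open>H\<close>, which stays Metzler. Using half the rate keeps the row sums strictly
  negative, so the comparison with zero forcing bounds the weighted facet values.\<close>

lemma homogeneous_upper_bound:
  assumes v: "\<And>t. 0 \<le> t \<Longrightarrow> (v has_vector_derivative A *v v t) (at t within {0..})"
  shows "\<exists>k. \<forall>t\<ge>0. \<forall>i. (M *v v t) $ i \<le> k * exp (- (\<gamma> / 2 * t))"
proof -
  define c where "c = \<gamma> / 2"
  define H' where "H' = H + c *\<^sub>R mat 1"
  define z where "z t = exp (c * t) *\<^sub>R (M *v v t)" for t
  \<comment> \<open>The leading \<open>1\<close> keeps \<open>k\<close> positive even when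
    \<open>z 0 = 0\<close>; otherwise the barrier would not be strict.\<close>
  define k where "k = 1 + (\<Sum>i\<in>UNIV. \<bar>z 0 $ i\<bar>)"
  have k: "1 + \<bar>z 0 $ i\<bar> \<le> k" for i
    unfolding k_def by (intro add_left_mono member_le_sum[of i UNIV "\<lambda>i. \<bar>z 0 $ i\<bar>"]) auto
  have H': "H' *v w = H *v w + c *\<^sub>R w" for w
    by (simp add: H'_def matrix_vector_mult_add_rdistrib scaleR_matrix_vector_assoc[symmetric])
  have Mv: "((\<lambda>t. M *v v t) has_vector_derivative M *v (A *v v t)) (at t within {0..})" if "0 \<le> t" for t
    by (rule bounded_linear.has_vector_derivative[OF matrix_vector_mul_bounded_linear v[OF that]])
  have z: "(z has_vector_derivative H' *v z t) (at t within {0..})" if "0 \<le> t" for t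
    unfolding z_def H'
    by (rule has_vector_derivative_eq_rhs[OF has_vector_derivative_scaleR[OF _ Mv[OF that]]])
      (auto intro!: derivative_eq_intros simp: M_A matrix_vector_mult_scaleR algebra_simps)
  have cont: "continuous_on {0..} z"
    unfolding continuous_on_eq_continuous_within
    using has_vector_derivative_continuous[OF z] by auto
  have traj: "trajectory (\<lambda>x (_::unit). H' *v x) (\<lambda>_. ()) z"
    by (intro trajectory_of_derivative z
        matrix_vector_mult_linear_continuous_on[THEN continuous_on_compose2] cont) auto
  have "z t $ i \<le> k" if t: "0 \<le> t" for t i
  proof (rule metzler_comparison[of H', OF _ cont _ _ _ t])
    show "metzler H'"
      using metzler by (simp add: metzler_def H'_def mat_def)
    show "z 0 $ i \<le> k" for i
      using k[of i] by simp
    show "k * (H' *v 1) $ i + (0::real^'l) $ i < 0" for i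
    proof -
      have "(H' *v 1) $ i < 0"
        using H_one_nth[of i] \<gamma> by (simp add: H' c_def)
      moreover have "k > 0" using k[of i] by linarith
      ultimately show ?thesis by (simp add: mult_pos_neg)
    qed
    fix i and s t :: real
    assume st: "0 \<le> s" "s \<le> t"
      and "\<And>u. u \<in> {s..t} \<Longrightarrow> (H' *v z u) $ i + (0::real^'l) $ i \<le> 0"
    then show "z t $ i \<le> z s $ i"
      by (intro trajectory_functional_decreasing[OF traj bounded_linear_vec_nth]) auto
  qed
  then have "\<forall>t\<ge>0. \<forall>i. (M *v v t) $ i \<le> k * exp (- (\<gamma> / 2 * t))"
    by (simp add: z_def c_def exp_minus field_simps)
  then show ?thesis by blast
qed

text \<open>The upper bound for \<open>v\<close> and for \<open>- v\<close> squeezes every facet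
  value to zero, and the left inverse \<open>V\<close> transfers the limit to
  \<open>v\<close>.\<close>

lemma homogeneous_tendsto_0:
  assumes v: "\<And>t. 0 \<le> t \<Longrightarrow> (v has_vector_derivative A *v v t) (at t within {0..})"
  shows "(v \<longlongrightarrow> 0) at_top"
proof -
  obtain k where k: "\<And>t i. t \<ge> 0 \<Longrightarrow> (M *v v t) $ i \<le> k * exp (- (\<gamma> / 2 * t))"
    using homogeneous_upper_bound[OF v] by blast
  have "\<exists>k. \<forall>t\<ge>0. \<forall>i. (M *v - v t) $ i \<le> k * exp (- (\<gamma> / 2 * t))"
    by (rule homogeneous_upper_bound) (auto intro!: derivative_eq_intros v
      simp: linear_neg[OF matrix_vector_mul_linear])
  then obtain k' where k': "\<And>t i. t \<ge> 0 \<Longrightarrow> - (M *v v t) $ i \<le> k' * exp (- (\<gamma> / 2 * t))"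
    by (auto simp: linear_neg[OF matrix_vector_mul_linear])
  have lim: "((\<lambda>t. c * exp (- (\<gamma> / 2 * t))) \<longlongrightarrow> 0) at_top" for c
  proof -
    have "filterlim (\<lambda>t. - (\<gamma> / 2 * t)) at_bot at_top"
      unfolding filterlim_uminus_at_bot minus_minus
      by (rule filterlim_tendsto_pos_mult_at_top[OF tendsto_const _ filterlim_ident]) (use \<gamma> in simp)
    then show ?thesis
      by (intro tendsto_mult_right_zero filterlim_compose[OF exp_at_bot])
  qed
  have "((\<lambda>t. (M *v v t) $ i) \<longlongrightarrow> 0) at_top" for i
  proof (rule tendsto_sandwich)
    show "\<forall>\<^sub>F t in at_top. - k' * exp (- (\<gamma> / 2 * t)) \<le> (M *v v t) $ i"
      using eventually_ge_at_top[of 0] by eventually_elim (smt (verit) k' mult_minus_left)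
    show "\<forall>\<^sub>F t in at_top. (M *v v t) $ i \<le> k * exp (- (\<gamma> / 2 * t))"
      using eventually_ge_at_top[of 0] by eventually_elim (use k in fastforce)
  qed (rule lim)+
  then have "((\<lambda>t. M *v v t) \<longlongrightarrow> 0) at_top"
    by (intro vec_tendstoI) simp
  then have "((\<lambda>t. V *v (M *v v t)) \<longlongrightarrow> V *v 0) at_top"
    by (rule bounded_linear.tendsto[OF matrix_vector_mul_bounded_linear])
  then show ?thesis by (simp add: V_M)
qed

text \<open>
  The internal model: \<open>x'' + \<alpha> x\<close> solves the unforced system, since \<open>r'' + \<alpha> r = 0\<close>.
\<close>

lemma internal_model_tendsto_0:
  assumes x: "trajectory sys r x" and r: "reference_signal \<alpha> r"
  shows "\<exists>r'. ((\<lambda>t. A *v sys (x t) (r t) + B *v vec (r' t) + \<alpha> *\<^sub>R x t) \<longlongrightarrow> 0) at_top"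
proof -
  obtain r' r'' where r': "\<And>t. t \<ge> 0 \<Longrightarrow> (r has_real_derivative r' t) (at t within {0..})"
    and r'': "\<And>t. t \<ge> 0 \<Longrightarrow> (r' has_real_derivative r'' t) (at t within {0..})"
    and eq: "\<And>t. t \<ge> 0 \<Longrightarrow> r'' t + \<alpha> * r t = 0"
    using r by (auto simp: reference_signal_def)
  note B = bounded_linear_mult_vec[of B]
  note derivB = bounded_linear.has_vector_derivative[OF B]
  note derivA = bounded_linear.has_vector_derivative[OF matrix_vector_mul_bounded_linear[of A]]
  have "continuous_on {0..} r"
    using r' by (intro DERIV_continuous_on) auto
  then have cont: "continuous_on {0..} (\<lambda>t. sys (x t) (r t))"
    unfolding sys_def
    by (intro continuous_intros bounded_linear.continuous_on[OF B]
        matrix_vector_mult_linear_continuous_on[THEN continuous_on_compose2]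
        trajectory_continuous_on[OF x]) auto
  \<comment> \<open>This is \<open>x'' + \<alpha> x\<close> written out, with
    \<open>x' = sys x r\<close> and \<open>x'' = A x' + B r'\<close>.\<close>
  let ?v = "\<lambda>t. A *v sys (x t) (r t) + B *v vec (r' t) + \<alpha> *\<^sub>R x t"
  have "(?v has_vector_derivative A *v ?v t) (at t within {0..})" if t: "0 \<le> t" for t
  proof -
    have dx: "(x has_vector_derivative sys (x t) (r t)) (at t within {0..})"
      by (rule trajectory_has_vector_derivative[OF x cont t])
    have dr: "(r has_vector_derivative r' t) (at t within {0..})"
      "(r' has_vector_derivative r'' t) (at t within {0..})"
      using r'[OF t] r''[OF t] by (simp_all add: has_real_derivative_iff_has_vector_derivative)
    have "((\<lambda>t. sys (x t) (r t)) has_vector_derivative A *v sys (x t) (r t) + B *v vec (r' t))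
        (at t within {0..})"
      unfolding sys_def[of "x _"]
      by (intro has_vector_derivative_add derivA derivB dr dx[unfolded sys_def])
    then have "(?v has_vector_derivative A *v (A *v sys (x t) (r t) + B *v vec (r' t))
        + B *v vec (r'' t) + \<alpha> *\<^sub>R sys (x t) (r t)) (at t within {0..})"
      by (intro has_vector_derivative_add derivA derivB dr)
        (auto intro!: derivative_eq_intros dx)
    \<comment> \<open>This term cancels the input part of
      \<open>\<alpha> *\<^sub>R sys (x t) (r t)\<close>, leaving
      \<open>\<alpha> *\<^sub>R (A *v x t)\<close>, so that \<open>A\<close> factors out of the
      derivative.\<close>
    moreover have "B *v vec (r'' t) = - \<alpha> *\<^sub>R (B *v vec (r t))"
    proof -
      have "r'' t = - \<alpha> * r t" using eq[OF t] by simp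
      then show ?thesis using linear_scale[OF bounded_linear.linear[OF B], of "- \<alpha>" "r t"] by simp
    qed
    ultimately show ?thesis
      by (simp add: sys_def matrix_vector_right_distrib matrix_vector_mult_scaleR scaleR_add_right add_ac)
  qed
  then have "(?v \<longlongrightarrow> 0) at_top"
    by (rule homogeneous_tendsto_0)
  then show ?thesis by blast
qed

end


section \<open>Block matrix products\<close>

lemma sum_UNIV_Plus:
  fixes g :: "'m::finite + 'n::finite \<Rightarrow> 'a::comm_monoid_add"
  shows "(\<Sum>i\<in>UNIV. g i) = (\<Sum>i\<in>UNIV. g (Inl i)) + (\<Sum>i\<in>UNIV. g (Inr i))"
  by (subst UNIV_Plus_UNIV[symmetric], subst sum.Plus) auto

lemma hcat_mult_vcat:
  fixes M :: "'a::semiring_1 ^ 'm ^ 'k" and N :: "'a ^ 'n ^ 'k"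
  shows "hcat M N *v vcat x y = M *v x + N *v y"
  by (simp add: vec_eq_iff matrix_vector_mult_def sum_UNIV_Plus hcat_def vcat_def)

lemma vcat_mult:
  fixes M :: "'a::semiring_1 ^ 'n ^ 'k" and N :: "'a ^ 'n ^ 'l"
  shows "vcat M N *v x = vcat (M *v x) (N *v x)"
  by (simp add: vec_eq_iff matrix_vector_mult_def vcat_def split: sum.split)

lemma vcat_eq_iff: "vcat x y = vcat x' y' \<longleftrightarrow> x = x' \<and> y = y'"
proof
  assume eq: "vcat x y = vcat x' y'"
  have "x $ i = x' $ i" "y $ j = y' $ j" for i j
    using arg_cong[OF eq, of "\<lambda>v. v $ Inl i"] arg_cong[OF eq, of "\<lambda>v. v $ Inr j"]
    by (simp_all add: vcat_def)
  then show "x = x' \<and> y = y'" by (simp add: vec_eq_iff)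
qed simp

lemma vcat_cases:
  obtains x y where "z = vcat x y"
proof
  show "z = vcat (\<chi> i. z $ Inl i) (\<chi> i. z $ Inr i)"
    by (simp add: vec_eq_iff vcat_def split: sum.split)
qed

lemma vcat3_cases:
  obtains x p q where "z = vcat x (vcat p q)"
proof -
  obtain x y where "z = vcat x y" by (rule vcat_cases)
  moreover obtain p q where "y = vcat p q" by (rule vcat_cases)
  ultimately show thesis using that by simp
qed

lemma vcat_add: "vcat x y + vcat x' y' = vcat (x + x') (y + y')"
  by (simp add: vec_eq_iff vcat_def split: sum.split)

lemma vcat_scaleR: "c *\<^sub>R vcat x y = vcat (c *\<^sub>R x) (c *\<^sub>R y)"
  by (simp add: vec_eq_iff vcat_def split: sum.split)

lemma mat_mult_vec1: "(mat c :: real ^ 1 ^ 1) *v x = c *\<^sub>R x"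
  by (simp add: vec_eq_iff matrix_vector_mult_def mat_def sum_1)

lemmas block_simps = hcat_mult_vcat vcat_mult vcat_add vcat_scaleR mat_mult_vec1

section \<open>The closed loop in block form and the tracking theorem\<close>

lemma A_cl_mult:
  "A_cl A B C \<alpha> K KI1 KI2 *v vcat x (vcat p q) =
     vcat ((A + B ** K ** C) *v x + (B ** KI1) *v p + (B ** KI2) *v q)
       (vcat (- (C *v x) - \<alpha> *\<^sub>R q) p)"
  by (simp add: A_cl_def block_simps vcat_eq_iff add.assoc)
    (simp add: vec_eq_iff matrix_vector_mult_def sum_negf)

lemma B_cl_mult: "B_cl B Kr *v x = vcat ((B ** Kr) *v x) (vcat x 0)"
  by (simp add: B_cl_def block_simps)

lemma unit_polyhedron_mult_le:
  fixes M :: "real ^ 'n ^ 'l" and T :: "real ^ 'l ^ 'k"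
  assumes "x \<in> unit_polyhedron M" "0 \<le> T"
  shows "T *v (M *v x) \<le> T *v 1"
  using assms by (intro nonneg_matrix_mono) (simp_all add: unit_polyhedron_def)

text \<open>Both matrix identities are tested on vectors. On a block vector, the intertwining of
  \<open>H\<close> with the closed loop splits into the three equations \<open>HL\<close>,
  \<open>HLI1\<close> and \<open>HLI2\<close>, one per block column.\<close>

lemma closed_loop_certificate:
  fixes A :: "real ^ 'n ^ 'n" and L :: "real ^ 'n ^ 'l"
  assumes "metzler H" "0 \<le> Hr" "\<gamma> > 0" "0 \<le> \<rho>"
    and HL: "H ** L = L ** (A + B ** K ** C) - LI1 ** C"
    and HLI1: "H ** LI1 = L ** B ** KI1 + LI2"
    and HLI2: "H ** LI2 = L ** B ** KI2 - \<alpha> *\<^sub>R LI1"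
    and HrR: "Hr ** R_mat = L ** B ** Kr + LI1"
    and "H *v 1 + Hr *v \<rho> \<le> - \<gamma> *\<^sub>R 1"
    and "V ** hcat L (hcat LI1 LI2) = mat 1"
  shows "polyhedral_certificate (A_cl A B C \<alpha> K KI1 KI2) (B_cl B Kr) (hcat L (hcat LI1 LI2)) V H Hr \<rho> \<gamma>"
proof
  let ?M = "hcat L (hcat LI1 LI2)"
  have "H *v (?M *v w) = ?M *v (A_cl A B C \<alpha> K KI1 KI2 *v w)" for w
  proof -
    obtain x p q where w: "w = vcat x (vcat p q)"
      by (rule vcat3_cases)
    have "H *v (?M *v w) = (H ** L) *v x + (H ** LI1) *v p + (H ** LI2) *v q"
      by (simp add: w block_simps matrix_vector_right_distrib matrix_vector_mul_assoc add.assoc)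
    also have "\<dots> = ?M *v (A_cl A B C \<alpha> K KI1 KI2 *v w)"
      unfolding HL HLI1 HLI2
      by (simp add: w A_cl_mult block_simps matrix_add_ldistrib matrix_vector_right_distrib matrix_vector_mult_diff_distrib
          matrix_vector_mult_add_rdistrib matrix_vector_mult_diff_rdistrib
          linear_neg[OF matrix_vector_mul_linear] matrix_vector_mult_scaleR
          scaleR_matrix_vector_assoc[symmetric] matrix_vector_mul_assoc matrix_mul_assoc algebra_simps)
    finally show ?thesis .
  qed
  then show "H ** ?M = ?M ** A_cl A B C \<alpha> K KI1 KI2"
    by (simp add: matrix_eq matrix_vector_mul_assoc)
  have "(Hr ** R_mat) *v w = ?M *v (B_cl B Kr *v w)" for w
    unfolding HrR
    by (simp add: B_cl_mult block_simps matrix_vector_mult_add_rdistrib matrix_vector_mul_assoc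
        matrix_mul_assoc)
  then show "Hr ** R_mat = ?M ** B_cl B Kr"
    by (simp add: matrix_eq matrix_vector_mul_assoc)
qed (fact assms)+

theorem theorem1:
  fixes A :: "real ^ 'n ^ 'n" and B :: "real ^ 'm ^ 'n" and C :: "real ^ 'n ^ 1"
    and \<alpha> :: real
    and X :: "real ^ 'n ^ 'lx" and U :: "real ^ 'm ^ 'lu"
    and XI1 XI2 :: "real ^ 1 ^ 2"
    and \<rho> :: "real ^ 2"
    and K KI1 KI2 Kr :: "real ^ 1 ^ 'm"
    and L :: "real ^ 'n ^ 'l" and LI1 LI2 :: "real ^ 1 ^ 'l"
  defines "L_cl \<equiv> hcat L (hcat LI1 LI2)"
  assumes "controllable A B" and "observable C A"
    and "\<alpha> = 0 \<or> (\<exists>\<omega>>0. \<alpha> = \<omega>\<^sup>2)"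
    and "\<And>\<sigma>::complex. \<sigma>\<^sup>2 + of_real \<alpha> = 0 \<Longrightarrow>
           rank (vcat (hcat (map_matrix of_real A - mat \<sigma>) (map_matrix of_real B))
                      (hcat (map_matrix of_real C) 0)) = CARD('n) + 1"
    and "\<And>i. 0 < \<rho> $ i"
    and "CARD('l) > CARD('n) + 2"
    and a: "\<exists>(H :: real ^ 'l ^ 'l) (Hr :: real ^ 2 ^ 'l) (\<gamma> :: real).
           metzler H \<and> 0 \<le> Hr \<and> \<gamma> > 0 \<and>
           H ** L = L ** (A + B ** K ** C) - LI1 ** C \<and>
           H ** LI1 = L ** B ** KI1 + LI2 \<and>
           H ** LI2 = L ** B ** KI2 - \<alpha> *\<^sub>R LI1 \<and>
           Hr ** R_mat = L ** B ** Kr + LI1 \<and>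
           H *v 1 + Hr *v \<rho> \<le> - \<gamma> *\<^sub>R 1"
    and b: "\<exists>(V1 :: real ^ 'l ^ 'n) (V2 :: real ^ 'l ^ 1) (V3 :: real ^ 'l ^ 1).
           vcat V1 (vcat V2 V3) ** L_cl = mat 1"
    and c: "\<exists>(T1 :: real ^ 'l ^ 'lx) (T2 :: real ^ 'l ^ 2) (T3 :: real ^ 'l ^ 2).
           0 \<le> T1 \<and> 0 \<le> T2 \<and> 0 \<le> T3 \<and>
           vcat T1 (vcat T2 T3) ** L_cl =
             vcat (hcat X (hcat 0 0)) (vcat (hcat 0 (hcat XI1 0)) (hcat 0 (hcat 0 XI2))) \<and>
           T1 *v 1 \<le> 1 \<and> T2 *v 1 \<le> 1 \<and> T3 *v 1 \<le> 1"
    and d: "\<exists>(Q :: real ^ 'l ^ 'lu) (Qr :: real ^ 2 ^ 'lu).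
           0 \<le> Q \<and> 0 \<le> Qr \<and>
           Q ** L = U ** K ** C \<and> Q ** LI1 = U ** KI1 \<and> Q ** LI2 = U ** KI2 \<and>
           Qr ** R_mat = U ** Kr \<and> Q *v 1 + Qr *v \<rho> \<le> 1"
  shows
    "robust_positively_invariant (closed_loop A B C \<alpha> K KI1 KI2 Kr) (ref_set \<rho>) (unit_polyhedron L_cl)
     \<and>
     unit_polyhedron L_cl \<subseteq> X_cl X XI1 XI2
     \<and>
     (\<lambda>x. hcat (K ** C) (hcat KI1 KI2) *v x) ` unit_polyhedron L_cl + (\<lambda>r. Kr *v vec r) ` ref_set \<rho>
       \<subseteq> unit_polyhedron U
     \<and>
     (\<forall>(x :: real \<Rightarrow> real ^ 'n) (xI1 :: real \<Rightarrow> real ^ 1) (xI2 :: real \<Rightarrow> real ^ 1) (r :: real \<Rightarrow> real).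
        trajectory (closed_loop A B C \<alpha> K KI1 KI2 Kr) r (\<lambda>t. vcat (x t) (vcat (xI1 t) (xI2 t))) \<longrightarrow>
        vcat (x 0) (vcat (xI1 0) (xI2 0)) \<in> unit_polyhedron L_cl \<longrightarrow>
        reference_signal \<alpha> r \<longrightarrow> (\<forall>t\<ge>0. r t \<in> ref_set \<rho>) \<longrightarrow>
        (let y = (\<lambda>t. C *v x t);
             u = (\<lambda>t. K *v y t + KI1 *v xI1 t + KI2 *v xI2 t + Kr *v vec (r t))
         in ((\<lambda>t. r t - y t $ 1) \<longlongrightarrow> 0) at_top \<and>
            (\<forall>t\<ge>0. vcat (x t) (vcat (xI1 t) (xI2 t)) \<in> X_cl X XI1 XI2 \<and>
                    x t \<in> unit_polyhedron X \<and> u t \<in> unit_polyhedron U)))"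
proof -
  let ?f = "closed_loop A B C \<alpha> K KI1 KI2 Kr"
  obtain H Hr \<gamma> where H: "metzler H" "0 \<le> Hr" "\<gamma> > 0"
    "H ** L = L ** (A + B ** K ** C) - LI1 ** C" "H ** LI1 = L ** B ** KI1 + LI2"
    "H ** LI2 = L ** B ** KI2 - \<alpha> *\<^sub>R LI1" "Hr ** R_mat = L ** B ** Kr + LI1"
    "H *v 1 + Hr *v \<rho> \<le> - \<gamma> *\<^sub>R 1"
    using a by blast
  obtain V where V: "V ** hcat L (hcat LI1 LI2) = mat 1"
    using b unfolding L_cl_def by blast
  have \<rho>: "0 \<le> \<rho>"
    using \<open>\<And>i. 0 < \<rho> $ i\<close> by (simp add: less_eq_vec_def less_imp_le)
  interpret polyhedral_certificate "A_cl A B C \<alpha> K KI1 KI2" "B_cl B Kr" L_cl V H Hr \<rho> \<gamma>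
    unfolding L_cl_def using H V \<rho> by (intro closed_loop_certificate)
  have sys: "sys = ?f"
    by (simp add: fun_eq_iff sys_def closed_loop_def)
  obtain T1 T2 T3 where T: "0 \<le> T1" "0 \<le> T2" "0 \<le> T3"
    "vcat T1 (vcat T2 T3) ** L_cl =
       vcat (hcat X (hcat 0 0)) (vcat (hcat 0 (hcat XI1 0)) (hcat 0 (hcat 0 XI2)))"
    "T1 *v 1 \<le> 1" "T2 *v 1 \<le> 1" "T3 *v 1 \<le> 1"
    using c by blast
  obtain Q Qr where Q: "0 \<le> Q" "0 \<le> Qr" "Q ** L = U ** K ** C" "Q ** LI1 = U ** KI1"
    "Q ** LI2 = U ** KI2" "Qr ** R_mat = U ** Kr" "Q *v 1 + Qr *v \<rho> \<le> 1"
    using d by blast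
  \<comment> \<open>The block rows of condition (c) express each state constraint as a non-negative
    combination of facet inequalities whose right-hand sides add up to at most one.\<close>
  have state: "X *v x \<le> 1 \<and> XI1 *v p \<le> 1 \<and> XI2 *v q \<le> 1"
    if w: "vcat x (vcat p q) \<in> unit_polyhedron L_cl" for x p q
  proof -
    let ?w = "vcat x (vcat p q)"
    have "vcat T1 (vcat T2 T3) *v (L_cl *v ?w) = vcat (X *v x) (vcat (XI1 *v p) (XI2 *v q))"
      by (simp add: matrix_vector_mul_assoc T(4)) (simp add: block_simps)
    then have "T1 *v (L_cl *v ?w) = X *v x" "T2 *v (L_cl *v ?w) = XI1 *v p" "T3 *v (L_cl *v ?w) = XI2 *v q"
      by (simp_all add: block_simps vcat_eq_iff)
    then show ?thesis
      using unit_polyhedron_mult_le[OF w] T by (metis order_trans)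
  qed
  \<comment> \<open>Condition (d) splits \<open>U\<close> applied to the input into a part in
    \<open>L_cl *v w\<close> and a part in \<open>R_mat *v vec r\<close>. The two are bounded
    independently, which is what the Minkowski sum requires.\<close>
  have input: "hcat (K ** C) (hcat KI1 KI2) *v w + Kr *v vec r \<in> unit_polyhedron U"
    if w: "w \<in> unit_polyhedron L_cl" and r: "r \<in> ref_set \<rho>" for w r
  proof -
    obtain x p q where xpq: "w = vcat x (vcat p q)"
      by (rule vcat3_cases)
    have "U *v (hcat (K ** C) (hcat KI1 KI2) *v w + Kr *v vec r)
        = (Q ** L) *v x + (Q ** LI1) *v p + (Q ** LI2) *v q + (Qr ** R_mat) *v vec r"
      unfolding Q
      by (simp add: xpq block_simps matrix_vector_right_distrib matrix_vector_mul_assoc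
          matrix_mul_assoc add.assoc)
    also have "\<dots> = Q *v (L_cl *v w) + Qr *v (R_mat *v vec r)"
      by (simp add: xpq L_cl_def block_simps matrix_vector_right_distrib matrix_vector_mul_assoc add.assoc)
    also have "\<dots> \<le> Q *v 1 + Qr *v \<rho>"
      using unit_polyhedron_mult_le[OF w Q(1)] nonneg_matrix_mono[OF Q(2)] r
      by (intro add_mono) (auto simp: ref_set_def)
    also have "\<dots> \<le> 1" by (rule Q)
    finally show ?thesis by (simp add: unit_polyhedron_def)
  qed
  have "unit_polyhedron L_cl \<subseteq> X_cl X XI1 XI2"
  proof
    fix w assume w: "w \<in> unit_polyhedron L_cl"
    obtain x p q where "w = vcat x (vcat p q)"
      by (rule vcat3_cases)
    then show "w \<in> X_cl X XI1 XI2"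
      using state w unfolding X_cl_def by blast
  qed
  moreover have "(\<lambda>x. hcat (K ** C) (hcat KI1 KI2) *v x) ` unit_polyhedron L_cl
      + (\<lambda>r. Kr *v vec r) ` ref_set \<rho> \<subseteq> unit_polyhedron U"
    using input by (auto elim!: set_plus_elim)
  moreover have "robust_positively_invariant ?f (ref_set \<rho>) (unit_polyhedron L_cl)"
    using robust_positively_invariant by (simp add: sys)
  moreover have "((\<lambda>t. r t - (C *v x t) $ 1) \<longlongrightarrow> 0) at_top"
    if traj: "trajectory ?f r (\<lambda>t. vcat (x t) (vcat (xI1 t) (xI2 t)))"
      and r: "reference_signal \<alpha> r" for x xI1 xI2 r
  proof -
    let ?w = "\<lambda>t. vcat (x t) (vcat (xI1 t) (xI2 t))"
    obtain r' where "((\<lambda>t. A_cl A B C \<alpha> K KI1 KI2 *v sys (?w t) (r t) + B_cl B Kr *v vec (r' t)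
        + \<alpha> *\<^sub>R ?w t) \<longlongrightarrow> 0) at_top"
      using internal_model_tendsto_0[of r ?w \<alpha>] traj r by (auto simp: sys)
    \<comment> \<open>The index \<open>Inr (Inr 1)\<close> selects the second integrator. Its row of
      \<open>B_cl\<close> is zero, so \<open>r'\<close> disappears, and
      \<open>xI2'' + \<alpha> xI2 = xI1' + \<alpha> xI2\<close> is the tracking error.\<close>
    then have "((\<lambda>t. (A_cl A B C \<alpha> K KI1 KI2 *v sys (?w t) (r t) + B_cl B Kr *v vec (r' t)
        + \<alpha> *\<^sub>R ?w t) $ Inr (Inr 1)) \<longlongrightarrow> (0 :: real ^ ('n + 1 + 1)) $ Inr (Inr 1)) at_top"
      by (rule tendsto_vec_nth)
    moreover have "(A_cl A B C \<alpha> K KI1 KI2 *v sys (?w t) (r t) + B_cl B Kr *v vec (r' t)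
        + \<alpha> *\<^sub>R ?w t) $ Inr (Inr 1) = r t - (C *v x t) $ 1" for t
      by (simp add: sys_def A_cl_mult B_cl_mult vcat_add vcat_scaleR) (simp add: vcat_def)
    ultimately show ?thesis by simp
  qed
  moreover have "vcat (x t) (vcat (xI1 t) (xI2 t)) \<in> unit_polyhedron L_cl \<and> x t \<in> unit_polyhedron X"
    if "trajectory ?f r (\<lambda>t. vcat (x t) (vcat (xI1 t) (xI2 t)))"
      "vcat (x 0) (vcat (xI1 0) (xI2 0)) \<in> unit_polyhedron L_cl"
      "\<forall>t\<ge>0. r t \<in> ref_set \<rho>" "0 \<le> t" for x xI1 xI2 r t
    using invariant[of r "\<lambda>t. vcat (x t) (vcat (xI1 t) (xI2 t))" t] that state
    by (simp add: sys unit_polyhedron_def[of X])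
  moreover have "K *v (C *v x) + KI1 *v p + KI2 *v q + Kr *v vec r \<in> unit_polyhedron U"
    if "vcat x (vcat p q) \<in> unit_polyhedron L_cl" "r \<in> ref_set \<rho>" for x p q r
    using input[OF that] by (simp add: block_simps matrix_vector_mul_assoc add.assoc)
  ultimately show ?thesis
    unfolding Let_def by (auto simp: subset_eq)
qed

end
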